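(* Let $(a,b)\in D_1$. Let $\boldsymbol{\alpha},\boldsymbol{\beta}\in\{0,1\}^{\mathbb N}$ be binary expansions of $2a$ and $2b-1$ respectively, i.e. $\pi(\boldsymbol{\alpha})=2a$ and $\pi(\boldsymbol{\beta})=2b-1$. Then $$\pi^{-1}(\Lambda_{(a,b)})=\Sigma_{(\boldsymbol{\alpha},\boldsymbol{\beta})}.$$
   Context: $S^1$ is identified with $[0,1)$ (endpoints glued), and $f:S^1\to S^1$, $f(x)=2x \bmod 1$. For $a,b\in S^1$, $a\ne b$, $(a,b)$ is the open arc from $a$ to $b$ (anticlockwise), and $X_{(a,b)}=\{x\in S^1 : f^n(x)\notin(a,b)\text{ for every } n\ge 0\}$. For $a\in(\frac14,\frac12)$ put $\chi(a)=\sup\{b\in S^1 : X_{(a,b)}\text{ is uncountable}\}$, and $D_1=\{(a,b)\in(\frac14,\frac12)\times(\frac12,\frac34) : b\le\chi(a)\}$. The attractor is $\Lambda_{(a,b)}=[2b-1,2a]\cap X_{(a,b)}$. $\mathbb N=\{1,2,\dots\}$, $\Sigma_2=\{0,1\}^{\mathbb N}$, $\sigma((x_i)_{i\ge1})=(x_{i+1})_{i\ge1}$, and $\pi:\Sigma_2\to[0,1]$, $\pi(\boldsymbol{x})=\sum_{i\ge1}x_i2^{-i}$. $\preccurlyeq$ is the lexicographic order on $\Sigma_2$. For $\boldsymbol{\alpha}$ beginning with $1$ and $\boldsymbol{\beta}$ beginning with $0$, $\Sigma_{(\boldsymbol{\alpha},\boldsymbol{\beta})}=\{\boldsymbol{x}\in\Sigma_2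 : \boldsymbol{\beta}\preccurlyeq\sigma^n(\boldsymbol{x})\preccurlyeq\boldsymbol{\alpha}\text{ for every }n\ge0\}$. *)

theory Defs
  imports "HOL-Analysis.Analysis" "HOL-Library.Fun_Lexorder"
begin

definition circle :: "real set" where
  "circle = {0..<1}"

definition doubling :: "real \<Rightarrow> real" where
  "doubling x = frac (2 * x)"

text \<open>
  The open arc from \<open>a\<close> to \<open>b\<close>, anticlockwise, for distinct points \<open>a\<close>, \<open>b\<close> of the circle.
  If \<open>b < a\<close> the arc passes through the glued endpoint 0.
\<close>
definition arc_from_to :: "real \<Rightarrow> real \<Rightarrow> real set" where
  "arc_from_to a b = (if a < b then {a<..<b} else {x \<in> circle. a < x \<or> x < b})"

definition avoiding_set :: "real \<Rightarrow> real \<Rightarrow> real set" where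
  "avoiding_set a b = {x \<in> circle. \<forall>n. (doubling ^^ n) x \<notin> arc_from_to a b}"

text \<open>The side condition \<open>b \<noteq> a\<close> is there because the arc is only defined for distinct endpoints.\<close>
definition chi :: "real \<Rightarrow> real" where
  "chi a = Sup {b \<in> circle. b \<noteq> a \<and> uncountable (avoiding_set a b)}"

definition D1 :: "(real \<times> real) set" where
  "D1 = {(a, b) \<in> {1/4<..<1/2} \<times> {1/2<..<3/4}. b \<le> chi a}"

definition attractor :: "real \<Rightarrow> real \<Rightarrow> real set" where
  "attractor a b = {2 * b - 1..2 * a} \<inter> avoiding_set a b"

text \<open>
  Binary sequences have type \<open>nat \<Rightarrow> bool\<close>, with \<open>False\<close> for 0 and \<open>True\<close> for 1.
  They are indexed from 0, so that \<open>x i\<close> is the digit of weight \<open>1 / 2 ^ (i + 1)\<close>.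
\<close>
type_synonym binseq = "nat \<Rightarrow> bool"

definition shift :: "binseq \<Rightarrow> binseq" where
  "shift x = (\<lambda>i. x (Suc i))"

definition binval :: "binseq \<Rightarrow> real" where
  "binval x = (\<Sum>i. of_bool (x i) / 2 ^ Suc i)"

text \<open>\<^const>\<open>less_fun\<close> is the strict lexicographic order.\<close>
definition lex_le :: "binseq \<Rightarrow> binseq \<Rightarrow> bool"  (infix "\<preceq>" 50) where
  "x \<preceq> y \<longleftrightarrow> less_fun x y \<or> x = y"

text \<open>Of interest when \<open>\<alpha>\<close> begins with 1 and \<open>\<beta>\<close> begins with 0.\<close>
definition lex_subshift :: "binseq \<Rightarrow> binseq \<Rightarrow> binseq set" where
  "lex_subshift \<alpha> \<beta> = {x. \<forall>n. \<beta> \<preceq> (shift ^^ n) x \<and> (shift ^^ n) x \<preceq> \<alpha>}"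

end

theory Submission
  imports Defs
begin

text \<open>
  The doubling map sends \<open>binval x\<close> to \<open>binval (shift x)\<close> unless \<open>binval (shift x) = 1\<close>, and the
  part of \<open>[2b - 1, 2a]\<close> outside \<open>(a, b)\<close> is mapped into \<open>[2b - 1, 2a]\<close>. So both sides of the
  claim say that every \<open>binval ((shift ^^ n) x)\<close> lies in \<open>[2b - 1, 2a]\<close>. Since this interval
  misses 0 and 1, no tail of \<open>x\<close> is constant, so the two binary expansions of a dyadic rational
  cause no trouble: the order on such tails compared with \<open>\<alpha>\<close> and \<open>\<beta>\<close> is the order of the values.
\<close>

lemma summable_binval: "summable (\<lambda>i. of_bool (x i) / 2 ^ Suc i :: real)"
proof (rule summable_comparison_test')
  show "summable (\<lambda>i. (1/2) ^ Suc i :: real)"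
    using sums_summable power_half_series by blast
qed (auto simp: power_divide)

lemma binval_nonneg: "0 \<le> binval x"
  unfolding binval_def by (intro suminf_nonneg summable_binval) auto

lemma binval_le_1: "binval x \<le> 1"
proof -
  have "binval x \<le> (\<Sum>i. (1/2) ^ Suc i)"
    unfolding binval_def
    by (intro suminf_le summable_binval sums_summable[OF power_half_series])
      (auto simp: power_divide)
  then show ?thesis
    using sums_unique[OF power_half_series] by simp
qed

lemma binval_shift: "2 * binval x = of_bool (x 0) + binval (shift x)"
proof -
  have "binval x = of_bool (x 0) / 2 + (\<Sum>i. of_bool (x (Suc i)) / 2 ^ Suc (Suc i))"
    unfolding binval_def using suminf_split_head[OF summable_binval[of x]] by simp
  also have "(\<Sum>i. of_bool (x (Suc i)) / 2 ^ Suc (Suc i)) = binval (shift x) / 2"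
    using suminf_divide[OF summable_binval[of "shift x"], of 2]
    by (simp add: binval_def shift_def mult.commute)
  finally show ?thesis by simp
qed

text \<open>Each shift doubles the value and removes the first digit; common digits cancel in the
  difference, and digit \<open>k\<close> contributes the 1. As tail values lie in [0,1], the right
  side is never negative and vanishes only for tails of value 0 in \<open>y\<close> and 1 in
  \<open>x\<close>.\<close>

lemma binval_diff:
  assumes "\<not> x k" "y k" "\<forall>j<k. x j = y j"
  shows "2 ^ Suc k * (binval y - binval x) =
    1 + binval ((shift ^^ Suc k) y) - binval ((shift ^^ Suc k) x)"
  using assms
proof (induction k arbitrary: x y)
  case 0
  then show ?case using binval_shift[of x] binval_shift[of y] by simp
next
  case (Suc k)
  have "2 ^ Suc k * (binval (shift y) - binval (shift x)) =
    1 + binval ((shift ^^ Suc k) (shift y)) - binval ((shift ^^ Suc k) (shift x))"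
    using Suc.prems by (intro Suc.IH) (auto simp: shift_def)
  moreover have "binval (shift y) - binval (shift x) = 2 * (binval y - binval x)"
    using binval_shift[of x] binval_shift[of y] Suc.prems(3) by simp
  ultimately show ?case
    by (simp add: funpow_swap1 algebra_simps)
qed

lemma less_fun_binval_diff:
  assumes "less_fun x y"
  obtains k where "2 ^ Suc k * (binval y - binval x) =
    1 + binval ((shift ^^ Suc k) y) - binval ((shift ^^ Suc k) x)"
proof -
  obtain k where "x k < y k" "\<forall>j<k. x j = y j"
    using assms by (auto simp: less_fun_def)
  then show thesis using binval_diff[of x k y] that by auto
qed

lemma binval_mono:
  assumes "x \<preceq> y"
  shows "binval x \<le> binval y"
proof (cases "x = y")
  case False
  then obtain k where "2 ^ Suc k * (binval y - binval x) =
      1 + binval ((shift ^^ Suc k) y) - binval ((shift ^^ Suc k) x)"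
    using assms less_fun_binval_diff unfolding lex_le_def by metis
  then have "0 \<le> 2 ^ Suc k * (binval y - binval x)"
    using binval_nonneg[of "(shift ^^ Suc k) y"] binval_le_1[of "(shift ^^ Suc k) x"] by linarith
  then show ?thesis by (simp add: zero_le_mult_iff power_le_zero_eq)
qed simp

lemma less_fun_if_not_lex_le: "\<not> x \<preceq> y \<Longrightarrow> less_fun y x"
proof -
  assume not_le: "\<not> x \<preceq> y"
  then obtain i where "x i \<noteq> y i" by (auto simp: lex_le_def)
  define k where "k = (LEAST i. x i \<noteq> y i)"
  have "x k \<noteq> y k" unfolding k_def using \<open>x i \<noteq> y i\<close> by (rule LeastI)
  moreover have agree: "\<forall>j<k. x j = y j" unfolding k_def using not_less_Least by blast
  moreover have "\<not> x k < y k" using not_le agree by (auto simp: lex_le_def less_fun_def)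
  ultimately show "less_fun y x" by (fastforce simp: less_fun_def)
qed

text \<open>The only obstruction is a pair x = w1000..., y = w0111... with equal values; positive
  tails of \<open>x\<close> exclude it.\<close>

lemma lex_le_of_binval_le:
  assumes "binval x \<le> binval y" "\<And>n. 0 < binval ((shift ^^ n) x)"
  shows "x \<preceq> y"
proof (rule ccontr)
  assume "\<not> x \<preceq> y"
  then obtain k where "2 ^ Suc k * (binval x - binval y) =
      1 + binval ((shift ^^ Suc k) x) - binval ((shift ^^ Suc k) y)"
    using less_fun_binval_diff less_fun_if_not_lex_le by metis
  then have "0 < 2 ^ Suc k * (binval x - binval y)"
    using assms(2)[of "Suc k"] binval_le_1[of "(shift ^^ Suc k) y"] by linarith
  then show False using assms(1) by (simp add: zero_less_mult_iff)
qed

text \<open>Mirror image: here the pair to exclude is x = w0111..., y = w1000....\<close>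

lemma lex_ge_of_binval_ge:
  assumes "binval y \<le> binval x" "\<And>n. binval ((shift ^^ n) x) < 1"
  shows "y \<preceq> x"
proof (rule ccontr)
  assume "\<not> y \<preceq> x"
  then obtain k where "2 ^ Suc k * (binval y - binval x) =
      1 + binval ((shift ^^ Suc k) y) - binval ((shift ^^ Suc k) x)"
    using less_fun_binval_diff less_fun_if_not_lex_le by metis
  then have "0 < 2 ^ Suc k * (binval y - binval x)"
    using assms(2)[of "Suc k"] binval_nonneg[of "(shift ^^ Suc k) y"] by linarith
  then show False using assms(1) by (simp add: zero_less_mult_iff)
qed

lemma lex_subshift_iff_binval:
  assumes "0 < binval \<beta>" "binval \<alpha> < 1"
  shows "x \<in> lex_subshift \<alpha> \<beta> \<longleftrightarrow>
    (\<forall>n. binval ((shift ^^ n) x) \<in> {binval \<beta>..binval \<alpha>})" (is "_ \<longleftrightarrow> ?R")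
proof
  assume ?R
  then have bounds: "binval \<beta> \<le> binval ((shift ^^ n) x)" "binval ((shift ^^ n) x) \<le> binval \<alpha>" for n
    by auto
  \<comment> \<open>The comparison lemmas are applied to each tail of \<open>x\<close>, so they need
    bounds on tails of tails.\<close>
  have tails: "(shift ^^ m) ((shift ^^ n) x) = (shift ^^ (m + n)) x" for m n
    by (simp add: funpow_add)
  have "0 < binval ((shift ^^ m) ((shift ^^ n) x))"
    "binval ((shift ^^ m) ((shift ^^ n) x)) < 1" for m n
    unfolding tails using assms bounds[of "m + n"] by linarith+
  then show "x \<in> lex_subshift \<alpha> \<beta>"
    unfolding lex_subshift_def using bounds lex_le_of_binval_le lex_ge_of_binval_ge by auto
qed (auto simp: lex_subshift_def binval_mono)

text \<open>The exception is the gluing of 1 to 0 on the circle: \<open>frac 1 = 0\<close>.\<close>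

lemma doubling_binval:
  "doubling (binval x) = (if binval (shift x) = 1 then 0 else binval (shift x))"
proof -
  have "doubling (binval x) = frac (binval (shift x))"
    by (cases "x 0") (simp_all add: doubling_def binval_shift frac_def)
  then show ?thesis
    using binval_nonneg[of "shift x"] binval_le_1[of "shift x"] by (auto simp: frac_eq)
qed

text \<open>The endpoints are the images of \<open>b\<close> and \<open>a\<close>. On the left piece
  2y \<ge> y as y > 0; on the right piece 2y - 1 \<le> y as y < 1. These give the other two
  bounds.\<close>

lemma doubling_in_interval:
  assumes "y \<in> {2 * b - 1..2 * a}" "y \<notin> {a<..<b}"
    and "0 < a" "a < 1/2" "1/2 < b" "b < 1"
  shows "doubling y \<in> {2 * b - 1..2 * a}"
proof (cases "y \<le> a")
  case True
  then have "doubling y = 2 * y"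
    using assms by (auto simp: doubling_def frac_eq)
  then show ?thesis using True assms by auto
next
  case False
  then have "b \<le> y" using assms by auto
  then have "doubling y = 2 * y - 1"
    using assms by (simp add: doubling_def frac_unique_iff)
  then show ?thesis using \<open>b \<le> y\<close> assms by auto
qed

lemma binval_in_attractor_iff:
  assumes "0 < a" "a < 1/2" "1/2 < b" "b < 1"
  shows "binval x \<in> attractor a b \<longleftrightarrow>
    (\<forall>n. binval ((shift ^^ n) x) \<in> {2 * b - 1..2 * a})" (is "_ \<longleftrightarrow> ?R")
proof
  assume "binval x \<in> attractor a b"
  then have start: "binval x \<in> {2 * b - 1..2 * a}"
    and avoid: "(doubling ^^ n) (binval x) \<notin> {a<..<b}" for n
    using assms by (auto simp: attractor_def avoiding_set_def arc_from_to_def)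
  \<comment> \<open>Both claims go through one induction: invariance of the interval is what rules
    out the glued endpoint.\<close>
  have "(doubling ^^ n) (binval x) = binval ((shift ^^ n) x) \<and>
    binval ((shift ^^ n) x) \<in> {2 * b - 1..2 * a}" for n
  proof (induction n)
    case (Suc n)
    have "doubling (binval ((shift ^^ n) x)) \<in> {2 * b - 1..2 * a}"
      using Suc avoid[of n] assms by (intro doubling_in_interval) auto
    \<comment> \<open>The exceptional value 0 lies below \<open>2 * b - 1\<close>.\<close>
    then show ?case
      using Suc assms doubling_binval[of "(shift ^^ n) x"] by (auto split: if_splits)
  qed (use start in simp)
  then show ?R by blast
next
  assume ?R
  then have bounds: "2 * b - 1 \<le> binval ((shift ^^ n) x)" "binval ((shift ^^ n) x) \<le> 2 * a" for n
    by auto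
  have "(doubling ^^ n) (binval x) = binval ((shift ^^ n) x)" for n
  proof (induction n)
    case (Suc n)
    \<comment> \<open>The next tail has value at most \<open>2 * a < 1\<close>, so no gluing
      occurs.\<close>
    then show ?case
      using bounds[of "Suc n"] assms doubling_binval[of "(shift ^^ n) x"] by auto
  qed simp
  \<comment> \<open>The bounds on the next tail suffice: first digit 0 gives a value at most
    \<open>a\<close>, first digit 1 a value at least \<open>b\<close>.\<close>
  moreover have "binval ((shift ^^ n) x) \<notin> {a<..<b}" for n
    using binval_shift[of "(shift ^^ n) x"] bounds[of "Suc n"]
    by (cases "(shift ^^ n) x 0") auto
  ultimately show "binval x \<in> attractor a b"
    using bounds[of 0] assms
    by (auto simp: attractor_def avoiding_set_def arc_from_to_def circle_def)
qed

theorem theorem2p8: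
  fixes a b :: real and \<alpha> \<beta> :: binseq
  assumes "(a, b) \<in> D1"
    and "binval \<alpha> = 2 * a"
    and "binval \<beta> = 2 * b - 1"
  shows "binval -` attractor a b = lex_subshift \<alpha> \<beta>"
proof -
  have "1/4 < a" "a < 1/2" "1/2 < b" "b < 3/4"
    using assms(1) by (auto simp: D1_def)
  \<comment> \<open>Here \<open>1/2 < b\<close> and \<open>a < 1/2\<close> yield
    \<open>0 < binval \<beta>\<close> and \<open>binval \<alpha> < 1\<close>.\<close>
  then show ?thesis
    using binval_in_attractor_iff[of a b] lex_subshift_iff_binval[of \<beta> \<alpha>] assms(2,3)
    by (simp add: vimage_def set_eq_iff)
qed

end
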